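(* Let $L\ge2$, $k\ge2$ be integers, $\kappa:\{1,\dots,k-1\}\times\mathbb{N}\to\{0,\dots,L-1\}$ a map, $(a(n))_{n=0}^\infty$ an $(L,k,\kappa)$-TM sequence, and $\beta>1$ an integer. Suppose all $a(n)\in\{0,1,\dots,\beta-1\}$ and the TM sequence is $n$-period. Then for all integers $N\ge0$, $l>0$, the irrationality exponent $\mu\big(\sum_{n=0}^\infty\frac{a(N+nl)}{\beta^{n+1}}\big)$ is finite, unless there exists an integer $A\ge0$ with $$\kappa(s,A+y)\equiv\kappa(1,A)\,s\,k^y\pmod L\quad\text{for all }1\le s\le k-1,\ y\in\mathbb{N}.$$
   Context: $\mathbb{N}$ is the set of non-negative integers. Let $a_0,\dots,a_{L-1}$ be pairwise distinct complex numbers and $f$ the map on $\{a_0,\dots,a_{L-1}\}$ with $f(a_i)=a_{i+1}$ (indices mod $L$), extended letterwise to words, with iterates $f^j$, $f^0=\mathrm{id}$. Define $A_0=a_0$, $A_{n+1}=A_n\,f^{\kappa(1,n)}(A_n)\cdots f^{\kappa(k-1,n)}(A_n)$ (concatenation); the limit infinite word, indexed from $0$, is the $(L,k,\kappa)$-TM sequence. It is called $n$-period if there exist integers $N_0\ge0$, $t>0$ with $\kappa(s,n)=\kappa(s,n+t)$ for all $1\le s\le k-1$, $n\ge N_0$. For an irrational real $\alpha$, the irrationality exponent $\mu(\alpha)$ is the supremum of real $\mu$ such that $|\alpha-p/q|<q^{-\mu}$ has infinitely many solutions in nonzero integers $p,q$. *)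

theory Defs
  imports "HOL-Analysis.Analysis" "HOL-Number_Theory.Cong"
begin

text \<open>Letters are represented by their indices 0..L-1; the letter with index i is
  a_i.  The map f sends index i to (i+1) mod L, so f^j sends i to (i+j) mod L.
  The block f^{kappa(s,n)}(A_n) for s = 0 is A_n itself (f^0 = id).\<close>

fun tm_word :: "nat \<Rightarrow> nat \<Rightarrow> (nat \<Rightarrow> nat \<Rightarrow> nat) \<Rightarrow> nat \<Rightarrow> nat list" where
  "tm_word L k \<kappa> 0 = [0]"
| "tm_word L k \<kappa> (Suc n) =
     concat (map (\<lambda>s. map (\<lambda>i. if s = 0 then i else (i + \<kappa> s n) mod L) (tm_word L k \<kappa> n))
                 [0..<k])"

text \<open>The limit infinite word (as letter indices): A_n has length k^n and is a prefix
  of A_{n+1}, so the m-th letter of the limit word is the m-th letter of A_{m+1}.\<close>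
definition tm_index :: "nat \<Rightarrow> nat \<Rightarrow> (nat \<Rightarrow> nat \<Rightarrow> nat) \<Rightarrow> nat \<Rightarrow> nat" where
  "tm_index L k \<kappa> m = tm_word L k \<kappa> (Suc m) ! m"

definition tm_seq :: "nat \<Rightarrow> nat \<Rightarrow> (nat \<Rightarrow> nat \<Rightarrow> nat) \<Rightarrow> (nat \<Rightarrow> complex) \<Rightarrow> nat \<Rightarrow> complex" where
  "tm_seq L k \<kappa> av m = av (tm_index L k \<kappa> m)"

definition n_period :: "nat \<Rightarrow> (nat \<Rightarrow> nat \<Rightarrow> nat) \<Rightarrow> bool" where
  "n_period k \<kappa> \<longleftrightarrow> (\<exists>N0 t. t > 0 \<and>
      (\<forall>s n. 1 \<le> s \<and> s \<le> k - 1 \<and> n \<ge> N0 \<longrightarrow> \<kappa> s n = \<kappa> s (n + t)))"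

text \<open>Irrationality exponent: supremum (in the extended reals) of those real mu such that
  |alpha - p/q| < q^(-mu) has infinitely many solutions with p, q nonzero integers
  (q taken positive, so that q^(-mu) makes sense).\<close>
definition irrationality_exponent :: "real \<Rightarrow> ereal" where
  "irrationality_exponent \<alpha> =
     Sup (ereal ` {\<mu>. infinite {(p::int, q::int). p \<noteq> 0 \<and> q > 0 \<and>
                                  \<bar>\<alpha> - real_of_int p / real_of_int q\<bar> < real_of_int q powr (- \<mu>)}})"

end

theory Submission
  imports Defs
begin

text \<open>The index of the \<open>m\<close>-th letter is a digit sum of \<open>m\<close> in base \<open>k\<close>, taken modulo \<open>L\<close>.
  For \<open>Q = k ^ (N0 + t * i)\<close>, the block of length \<open>Q\<close> that starts at position \<open>h * Q\<close> of the
  progression depends only on finitely many residues modulo \<open>L\<close>, attached to \<open>h\<close> independently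
  of \<open>i\<close>. So two such blocks, for some \<open>h < h'\<close> valid for every \<open>i\<close>, coincide, and this gives a
  sequence of good rational approximations with geometrically growing exponents. They yield a
  finite irrationality exponent unless the period \<open>(h' - h) * Q\<close> persists over arbitrarily
  large multiples of \<open>Q\<close>; but then the digit sum from \<open>N0\<close> on is periodic modulo \<open>L\<close>, hence
  linear on the multiples of some power of \<open>k\<close>, which is the exceptional case.\<close>

section \<open>Expansions in base \<open>\<beta>\<close> with signed digits\<close>

definition digit_value :: "nat \<Rightarrow> (nat \<Rightarrow> int) \<Rightarrow> real" where
  "digit_value \<beta> d = (\<Sum>n. real_of_int (d n) / real \<beta> ^ (n + 1))"

text \<open>Horner form of \<open>\<beta> ^ j\<close> times the sum of the first \<open>j\<close>
  terms, hence an integer. Digits are signed so that the difference of two expansions with digits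
  below \<open>\<beta>\<close> is again such an expansion.\<close>

primrec digit_prefix :: "nat \<Rightarrow> (nat \<Rightarrow> int) \<Rightarrow> nat \<Rightarrow> int" where
  "digit_prefix \<beta> d 0 = 0"
| "digit_prefix \<beta> d (Suc j) = int \<beta> * digit_prefix \<beta> d j + d j"

text \<open>The expansion all of whose digits are \<open>\<beta> - 1\<close>; it is the majorant for
  summability and for the bound 1 on signed expansions.\<close>

lemma geometric_digit_sums:
  assumes "\<beta> > 1"
  shows "(\<lambda>n. (real \<beta> - 1) / real \<beta> ^ (n + 1)) sums 1"
proof -
  have "(\<lambda>n. (real \<beta> - 1) / real \<beta> * (1 / real \<beta>) ^ n) sums ((real \<beta> - 1) / real \<beta> * (1 / (1 - 1 / real \<beta>)))"
    using assms by (intro sums_mult geometric_sums) auto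
  moreover have "(real \<beta> - 1) / real \<beta> * (1 / (1 - 1 / real \<beta>)) = 1"
    using assms by (simp add: field_simps)
  moreover have "(\<lambda>n. (real \<beta> - 1) / real \<beta> * (1 / real \<beta>) ^ n) = (\<lambda>n. (real \<beta> - 1) / real \<beta> ^ (n + 1))"
    by (simp add: power_divide)
  ultimately show ?thesis
    by metis
qed

lemma digit_term_bound:
  assumes "\<beta> > 1" "\<bar>d n\<bar> < int \<beta>"
  shows "norm (real_of_int (d n) / real \<beta> ^ (n + 1)) \<le> (real \<beta> - 1) / real \<beta> ^ (n + 1)"
proof -
  have "\<bar>real_of_int (d n)\<bar> \<le> real \<beta> - 1"
    using assms by linarith
  then show ?thesis
    using assms by (simp add: divide_right_mono)
qed

lemma digit_summable:
  assumes "\<beta> > 1" "\<And>n. \<bar>d n\<bar> < int \<beta>"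
  shows "summable (\<lambda>n. real_of_int (d n) / real \<beta> ^ (n + 1))"
  by (rule summable_comparison_test[OF _ sums_summable[OF geometric_digit_sums[OF assms(1)]]])
     (use digit_term_bound assms in blast)

lemma digit_value_le_1:
  assumes "\<beta> > 1" "\<And>n. \<bar>d n\<bar> < int \<beta>"
  shows "\<bar>digit_value \<beta> d\<bar> \<le> 1"
proof -
  have "norm (digit_value \<beta> d) \<le> (\<Sum>n. (real \<beta> - 1) / real \<beta> ^ (n + 1))"
    unfolding digit_value_def
    by (rule norm_suminf_le[OF _ sums_summable[OF geometric_digit_sums[OF assms(1)]]])
       (use digit_term_bound assms in blast)
  then show ?thesis
    using sums_unique[OF geometric_digit_sums[OF assms(1)]] by simp
qed

lemma digit_value_unfold:
  assumes "\<beta> > 1" "\<And>n. \<bar>d n\<bar> < int \<beta>"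
  shows "real \<beta> * digit_value \<beta> d = d 0 + digit_value \<beta> (\<lambda>n. d (Suc n))"
proof -
  let ?t = "\<lambda>d n. real_of_int (d n) / real \<beta> ^ (n + 1)"
  have "digit_value \<beta> d = ?t d 0 + (\<Sum>n. ?t d (Suc n))"
    using suminf_split_head[OF digit_summable, of \<beta> d] assms by (simp add: digit_value_def)
  also have "(\<Sum>n. ?t d (Suc n)) = (\<Sum>n. ?t (\<lambda>n. d (Suc n)) n / real \<beta>)"
    by (simp add: field_simps)
  also have "\<dots> = digit_value \<beta> (\<lambda>n. d (Suc n)) / real \<beta>"
    unfolding digit_value_def using assms by (intro suminf_divide digit_summable) auto
  finally show ?thesis
    using assms by (simp add: field_simps)
qed

lemma digit_value_shift:
  assumes "\<beta> > 1" "\<And>n. \<bar>d n\<bar> < int \<beta>"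
  shows "real \<beta> ^ j * digit_value \<beta> d = digit_prefix \<beta> d j + digit_value \<beta> (\<lambda>n. d (n + j))"
proof (induction j)
  case (Suc j)
  have "real \<beta> ^ Suc j * digit_value \<beta> d
      = real \<beta> * digit_prefix \<beta> d j + real \<beta> * digit_value \<beta> (\<lambda>n. d (n + j))"
    using Suc by (simp add: algebra_simps)
  then show ?case
    using digit_value_unfold[of \<beta> "\<lambda>n. d (n + j)"] assms by simp
qed simp

lemma digit_value_diff:
  assumes "\<beta> > 1" "\<And>n. \<bar>d n\<bar> < int \<beta>" "\<And>n. \<bar>d' n\<bar> < int \<beta>"
  shows "digit_value \<beta> d - digit_value \<beta> d' = digit_value \<beta> (\<lambda>n. d n - d' n)"
  unfolding digit_value_def
  using suminf_diff[OF digit_summable[of \<beta> d] digit_summable[of \<beta> d']] assms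
  by (simp add: diff_divide_distrib)

text \<open>Two expansions whose values nearly coincide may differ by a carry
  (a block of zeros facing a block of digits \<open>\<beta> - 1\<close>); a sequence and its own shift cannot,
  since the two blocks would overlap.\<close>

lemma small_shift_difference_imp_periodic:
  fixes b :: "nat \<Rightarrow> nat"
  assumes \<beta>: "\<beta> > 1" and b: "\<And>n. b n < \<beta>"
    and small: "\<bar>digit_value \<beta> (\<lambda>n. int (b (n + e)) - int (b n))\<bar> < 1 / real \<beta> ^ M"
    and j: "j + 1 + e < M"
  shows "b (j + e) = b j"
proof -
  define d where "d = (\<lambda>n. int (b (n + e)) - int (b n))"
  have d: "\<bar>d n\<bar> < int \<beta>" for n
    using b[of n] b[of "n + e"] by (auto simp: d_def)
  define S where "S = digit_prefix \<beta> d"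
  have S_Suc: "S (Suc i) = int \<beta> * S i + d i" for i
    by (simp add: S_def)
  \<comment> \<open>\<open>S i\<close> is \<open>\<beta> ^ i\<close> times a value below
    \<open>1 / \<beta> ^ M\<close>, minus a tail of size at most 1. An integer of size below 2 is
    -1, 0 or 1.\<close>
  have S_le: "\<bar>S i\<bar> \<le> 1" if "i \<le> M" for i
  proof -
    have "\<bar>real \<beta> ^ i * digit_value \<beta> d\<bar> < 1"
    proof -
      have "\<bar>real \<beta> ^ i * digit_value \<beta> d\<bar> = real \<beta> ^ i * \<bar>digit_value \<beta> d\<bar>"
        by (simp add: abs_mult)
      also have "\<dots> < real \<beta> ^ i * (1 / real \<beta> ^ M)"
        using small \<beta> by (intro mult_strict_left_mono) (auto simp: d_def)
      also have "\<dots> \<le> real \<beta> ^ M * (1 / real \<beta> ^ M)"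
        using that \<beta> by (intro mult_right_mono power_increasing) auto
      finally show ?thesis using \<beta> by simp
    qed
    moreover have "\<bar>digit_value \<beta> (\<lambda>n. d (n + i))\<bar> \<le> 1"
      using \<beta> d by (intro digit_value_le_1) auto
    ultimately have "\<bar>real_of_int (S i)\<bar> < 2"
      using digit_value_shift[where d = d, OF \<beta> d, of i] unfolding S_def by linarith
    then show ?thesis by linarith
  qed
  \<comment> \<open>As \<open>d i > - \<beta>\<close>, the recursion gives
    \<open>S (Suc i) = \<beta> + d i \<ge> 1\<close>; the bound by 1 forces equality. A carry, once
    present, thus persists up to \<open>M\<close>.\<close>
  have up: "S (Suc i) = 1 \<and> d i = 1 - int \<beta>" if "S i = 1" "i < M" for i
    using S_le[of "Suc i"] that d[of i] S_Suc[of i] by auto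
  have down: "S (Suc i) = - 1 \<and> d i = int \<beta> - 1" if "S i = - 1" "i < M" for i
    using S_le[of "Suc i"] that d[of i] S_Suc[of i] by auto
  have S0: "S i = 0" if i: "i + e < M" for i
  proof (rule ccontr)
    assume "S i \<noteq> 0"
    with S_le[of i] i have "S i = 1 \<or> S i = - 1" by auto
    then show False
    proof
      assume 1: "S i = 1"
      have "S (i + m) = 1" if "i + m \<le> M" for m
        using that by (induction m) (auto simp: 1 up)
      \<comment> \<open>The carry is still there \<open>e\<close> places later: \<open>d i\<close>
        forces \<open>b (i + e) = 0\<close>, while \<open>d (i + e)\<close> forces
        \<open>b (i + e) = \<beta> - 1\<close>.\<close>
      then have "d i = 1 - int \<beta>" "d (i + e) = 1 - int \<beta>"
        using up[of i] up[of "i + e"] i 1 by auto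
      then show False
        using b[of "i + e"] b[of i] b[of "i + e + e"] \<beta> by (auto simp: d_def)
    next
      assume 1: "S i = - 1"
      have "S (i + m) = - 1" if "i + m \<le> M" for m
        using that by (induction m) (auto simp: 1 down)
      then have "d i = int \<beta> - 1" "d (i + e) = int \<beta> - 1"
        using down[of i] down[of "i + e"] i 1 by auto
      then show False
        using b[of "i + e"] b[of i] b[of "i + e + e"] \<beta> by (auto simp: d_def)
    qed
  qed
  \<comment> \<open>\<open>S\<close> must vanish at both \<open>j\<close> and \<open>j + 1\<close>,
    hence the hypothesis \<open>j + 1 + e < M\<close>.\<close>
  have "d j = 0"
    using S0[of j] S0[of "Suc j"] S_Suc[of j] j by auto
  then show ?thesis by (simp add: d_def)
qed

section \<open>Bounding the irrationality exponent\<close>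

text \<open>For \<open>\<mu> \<ge> M\<close> a solution must have \<open>q < q0\<close>; its error
  is below 1, so \<open>p\<close> is bounded as well. Only finitely many solutions remain, and
  \<open>M\<close> bounds the supremum.\<close>

lemma irrationality_exponent_finiteI:
  assumes lower: "\<And>(p::int) (q::int). q \<ge> q0 \<Longrightarrow> \<bar>\<alpha> - p / q\<bar> \<ge> 1 / real_of_int q ^ M"
  shows "irrationality_exponent \<alpha> < \<infinity>"
proof -
  let ?A = "\<lambda>\<mu>. {(p::int, q::int). p \<noteq> 0 \<and> q > 0 \<and>
               \<bar>\<alpha> - real_of_int p / real_of_int q\<bar> < real_of_int q powr (- \<mu>)}"
  have fin: "finite (?A \<mu>)" if \<mu>: "\<mu> \<ge> real M" for \<mu>
  proof -
    define B where "B = \<lceil>\<bar>\<alpha>\<bar> + 1\<rceil> * q0"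
    have "?A \<mu> \<subseteq> {- B..B} \<times> {0..q0}"
    proof clarify
      fix p q :: int
      assume q: "q > 0" and less: "\<bar>\<alpha> - p / q\<bar> < real_of_int q powr (- \<mu>)"
      have "real_of_int q powr (- \<mu>) \<le> real_of_int q powr (- real M)"
        using q \<mu> by (intro powr_mono) auto
      also have "\<dots> = 1 / real_of_int q ^ M"
        using q by (simp add: powr_minus powr_realpow divide_inverse)
      finally have le: "real_of_int q powr (- \<mu>) \<le> 1 / real_of_int q ^ M" .
      then have q0: "q < q0"
        using lower[of q p] less by linarith
      have "1 / real_of_int q ^ M \<le> 1"
        using q by simp
      then have "\<bar>p / q\<bar> \<le> \<bar>\<alpha>\<bar> + 1"
        using less le by linarith
      then have "\<bar>real_of_int p\<bar> \<le> (\<bar>\<alpha>\<bar> + 1) * q"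
        using q by (simp add: field_simps)
      also have "\<dots> \<le> of_int \<lceil>\<bar>\<alpha>\<bar> + 1\<rceil> * of_int q0"
        using q q0 by (intro mult_mono) auto
      finally have "\<bar>p\<bar> \<le> B"
        unfolding B_def of_int_mult[symmetric] of_int_abs[symmetric] of_int_le_iff .
      then show "p \<in> {- B..B} \<and> q \<in> {0..q0}"
        using q q0 by auto
    qed
    then show ?thesis by (rule finite_subset) auto
  qed
  have "irrationality_exponent \<alpha> \<le> ereal (real M)"
    unfolding irrationality_exponent_def
  proof (rule SUP_least)
    fix \<mu> assume "\<mu> \<in> {\<mu>. infinite (?A \<mu>)}"
    then have "\<not> \<mu> \<ge> real M"
      using fin by blast
    then show "ereal \<mu> \<le> ereal (real M)" by simp
  qed
  then show ?thesis
    by (auto simp: less_top[symmetric] top_ereal_def)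
qed

text \<open>From \<open>2 * q \<le> q ^ 2\<close>: bounds that arise in terms of
  \<open>2 * q\<close> become bounds in \<open>q\<close> with doubled exponent.\<close>

lemma two_mult_power_le:
  fixes q :: real
  assumes "q \<ge> 2"
  shows "1 / q ^ (2 * m) \<le> 1 / (2 * q) ^ m"
proof -
  have "(2 * q) ^ m \<le> (q ^ 2) ^ m"
    using assms by (intro power_mono) (auto simp: power2_eq_square)
  then show ?thesis
    using assms by (intro divide_left_mono) (auto simp: power_mult)
qed

text \<open>The approximations are \<open>P / (\<beta> ^ (h' * Q) - \<beta> ^ (h * Q))\<close>, with \<open>Q\<close> growing
  geometrically. If \<open>p / q\<close> differs from the first of them with \<open>\<beta> ^ Q \<ge> 2 * q\<close>, it stays
  away from it by the usual gap of distinct fractions; if it is equal to it, the error of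
  approximation is known and is bounded below by the last hypothesis.\<close>

lemma irrationality_exponent_finite_of_repetitions:
  fixes b :: "nat \<Rightarrow> nat" and Q :: "nat \<Rightarrow> nat"
  assumes \<beta>: "\<beta> > 1" and b: "\<And>n. b n < \<beta>"
    and Q_pos: "\<And>i. Q i > 0" and Q_Suc: "\<And>i. Q (Suc i) = K * Q i" and K: "K \<ge> 2"
    and hh': "h < h'"
    and rep: "\<And>i n. n < Q i \<Longrightarrow> b (h * Q i + n) = b (h' * Q i + n)"
    and nonrep: "\<And>i. \<exists>x. h * Q i \<le> x \<and> x \<le> C * Q i \<and> b (x + (h' - h) * Q i) \<noteq> b x"
  shows "irrationality_exponent (\<Sum>n. real (b n) / real \<beta> ^ (n + 1)) < \<infinity>"
proof -
  define d where "d = (\<lambda>n. int (b n))"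
  have d: "\<bar>d n\<bar> < int \<beta>" for n
    using b by (simp add: d_def)
  define \<alpha> where "\<alpha> = digit_value \<beta> d"
  define T where "T i = digit_value \<beta> (\<lambda>n. d (n + h' * Q i) - d (n + h * Q i))" for i
  define P where "P i = digit_prefix \<beta> d (h' * Q i) - digit_prefix \<beta> d (h * Q i)" for i
  define R where "R i = int \<beta> ^ (h' * Q i) - int \<beta> ^ (h * Q i)" for i
  \<comment> \<open>Large enough that \<open>(x - h * Q i) + 1 + (h' - h) * Q i < E * Q i\<close>
    for all \<open>x \<le> C * Q i\<close>, as the comparison with a shift demands.\<close>
  define E where "E = C + (h' - h) + 3"
  have diff_bound: "\<bar>d (n + i) - d (n + j)\<bar> < int \<beta>" for n i j
    using b[of "n + i"] b[of "n + j"] by (auto simp: d_def)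
  have RP: "R i * \<alpha> - P i = T i" for i
  proof -
    have "T i = digit_value \<beta> (\<lambda>n. d (n + h' * Q i)) - digit_value \<beta> (\<lambda>n. d (n + h * Q i))"
      unfolding T_def using \<beta> d by (intro digit_value_diff[symmetric]) auto
    then show ?thesis
      using digit_value_shift[where d = d, OF \<beta> d, of "h * Q i"]
        digit_value_shift[where d = d, OF \<beta> d, of "h' * Q i"]
      by (simp add: R_def P_def \<alpha>_def algebra_simps)
  qed
  have R_pos: "R i > 0" for i
    using \<beta> hh' Q_pos[of i] by (simp add: R_def power_strict_increasing)
  have R_le: "real_of_int (R i) \<le> real \<beta> ^ (h' * Q i)" for i
    by (simp add: R_def)
  \<comment> \<open>By \<open>rep\<close> the first \<open>Q i\<close> digits of the difference
    vanish, leaving a tail of size at most 1 divided by \<open>\<beta> ^ Q i\<close>.\<close>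
  have T_upper: "\<bar>T i\<bar> \<le> 1 / real \<beta> ^ Q i" for i
  proof -
    define c where "c = (\<lambda>n. d (n + h' * Q i) - d (n + h * Q i))"
    have c: "\<bar>c n\<bar> < int \<beta>" for n
      unfolding c_def by (rule diff_bound)
    have "digit_prefix \<beta> c m = 0" if "m \<le> Q i" for m
      using that
    proof (induction m)
      case (Suc m)
      then have "c m = 0"
        using rep[of m i] by (simp add: c_def d_def add.commute)
      with Suc show ?case by simp
    qed simp
    then have "real \<beta> ^ Q i * T i = digit_value \<beta> (\<lambda>n. c (n + Q i))"
      using digit_value_shift[where d = c, OF \<beta> c, of "Q i"] by (simp add: T_def c_def)
    then have "\<bar>real \<beta> ^ Q i * T i\<bar> \<le> 1"
      using digit_value_le_1[OF \<beta>, of "\<lambda>n. c (n + Q i)"] c by simp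
    then show ?thesis
      using \<beta> by (simp add: abs_mult field_simps)
  qed
  \<comment> \<open>\<open>T i\<close> compares the sequence from \<open>h * Q i\<close> on with its
    own shift by \<open>(h' - h) * Q i\<close>; a smaller value would exclude the mismatch given by
    \<open>nonrep\<close>.\<close>
  have T_lower: "\<bar>T i\<bar> \<ge> 1 / real \<beta> ^ (E * Q i)" for i
  proof (rule ccontr)
    assume *: "\<not> ?thesis"
    let ?b = "\<lambda>n. b (n + h * Q i)"
    obtain x where x: "h * Q i \<le> x" "x \<le> C * Q i" "b (x + (h' - h) * Q i) \<noteq> b x"
      using nonrep by blast
    have hQ: "(h' - h) * Q i + h * Q i = h' * Q i"
      using hh' by (metis add_mult_distrib le_add_diff_inverse2 less_imp_le)
    have "E * Q i = C * Q i + (h' - h) * Q i + 3 * Q i"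
      by (simp add: E_def algebra_simps)
    then have "(x - h * Q i) + 1 + (h' - h) * Q i < E * Q i"
      using x Q_pos[of i] by linarith
    moreover have "\<bar>digit_value \<beta> (\<lambda>n. int (?b (n + (h' - h) * Q i)) - int (?b n))\<bar> < 1 / real \<beta> ^ (E * Q i)"
      using * by (simp add: T_def d_def add.assoc hQ)
    ultimately have "?b (x - h * Q i + (h' - h) * Q i) = ?b (x - h * Q i)"
      using \<beta> b by (intro small_shift_difference_imp_periodic) auto
    then show False
      using x by (simp add: add.commute)
  qed
  have Q_gt: "i < Q i" for i
  proof (induction i)
    case (Suc i)
    have "2 * Q i \<le> K * Q i" using K by simp
    then show ?case using Suc Q_Suc[of i] by linarith
  qed (rule Q_pos)
  \<comment> \<open>Minimality of \<open>i\<close> below will give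
    \<open>\<beta> ^ Q i \<le> (2 * q) ^ K\<close>. The two cases need the exponents
    \<open>K * (E + h')\<close> and \<open>1 + K * h'\<close>; \<open>F\<close> dominates
    both.\<close>
  define F where "F = 1 + K * (E + h')"
  \<comment> \<open>The threshold on \<open>q\<close> excludes \<open>i = 0\<close>, so that the
    minimal \<open>i\<close> has a predecessor.\<close>
  have main: "\<bar>\<alpha> - p / q\<bar> \<ge> 1 / real_of_int q ^ (2 * F)" if q: "q \<ge> int \<beta> ^ Q 0 + 2" for p q :: int
  proof -
    have "int \<beta> ^ Q 0 \<ge> 0" by simp
    with q have q2: "q \<ge> 2" by linarith
    define i where "i = (LEAST i. 2 * real_of_int q \<le> real \<beta> ^ Q i)"
    have ex: "2 * real_of_int q \<le> real \<beta> ^ Q (nat (2 * q))"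
    proof -
      have "2 * real_of_int q = real (nat (2 * q))"
        using q2 by simp
      also have "\<dots> \<le> 2 ^ nat (2 * q)"
        using of_nat_less_two_power[of "nat (2 * q)"] by (rule less_imp_le)
      also have "\<dots> \<le> real \<beta> ^ nat (2 * q)"
        using \<beta> by (intro power_mono) auto
      also have "\<dots> \<le> real \<beta> ^ Q (nat (2 * q))"
        using \<beta> Q_gt[of "nat (2 * q)"] by (intro power_increasing) auto
      finally show ?thesis .
    qed
    have i: "2 * real_of_int q \<le> real \<beta> ^ Q i"
      unfolding i_def by (rule LeastI[where P = "\<lambda>i. 2 * real_of_int q \<le> real \<beta> ^ Q i", OF ex])
    have "i \<noteq> 0"
    proof
      assume "i = 0"
      with i have "2 * real_of_int q \<le> real_of_int (int \<beta> ^ Q 0)" by simp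
      then have "2 * q \<le> int \<beta> ^ Q 0" by linarith
      with q q2 show False by linarith
    qed
    then obtain i' where i': "i = Suc i'"
      by (cases i) auto
    then have "\<not> 2 * real_of_int q \<le> real \<beta> ^ Q i'"
      unfolding i_def using not_less_Least[of i' "\<lambda>i. 2 * real_of_int q \<le> real \<beta> ^ Q i"] by simp
    then have "(real \<beta> ^ Q i') ^ K \<le> (2 * real_of_int q) ^ K"
      by (intro power_mono) auto
    then have upper: "real \<beta> ^ Q i \<le> (2 * real_of_int q) ^ K"
      using Q_Suc[of i'] by (simp add: i' power_mult[symmetric] mult.commute)
    have upper_pow: "real \<beta> ^ (m * Q i) \<le> (2 * real_of_int q) ^ (K * m)" for m
    proof -
      have "real \<beta> ^ (m * Q i) = (real \<beta> ^ Q i) ^ m"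
        by (simp add: power_mult[symmetric] mult.commute)
      also have "\<dots> \<le> ((2 * real_of_int q) ^ K) ^ m"
        using upper by (intro power_mono) auto
      finally show ?thesis by (simp add: power_mult)
    qed
    have dist: "\<alpha> - p / q = (P i * q - p * R i + T i * q) / (R i * q)"
      unfolding RP[symmetric] using R_pos[of i] q2 by (simp add: field_simps)
    have "\<bar>\<alpha> - p / q\<bar> \<ge> 1 / (2 * real_of_int q) ^ F"
    proof (cases "p * R i = P i * q")
      case True
      then have "real_of_int (P i) * real_of_int q = real_of_int p * real_of_int (R i)"
        by (metis of_int_mult)
      then have "\<bar>\<alpha> - p / q\<bar> = \<bar>T i\<bar> / R i"
        using dist R_pos[of i] q2 by (simp add: abs_mult)
      also have "\<dots> \<ge> (1 / real \<beta> ^ (E * Q i)) / real \<beta> ^ (h' * Q i)"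
        using T_lower[of i] R_le[of i] R_pos[of i] \<beta> by (intro frac_le) auto
      also have "(1 / real \<beta> ^ (E * Q i)) / real \<beta> ^ (h' * Q i) = 1 / real \<beta> ^ ((E + h') * Q i)"
        by (simp add: power_add add_mult_distrib)
      finally have "\<bar>\<alpha> - p / q\<bar> \<ge> 1 / real \<beta> ^ ((E + h') * Q i)" .
      moreover have "1 / real \<beta> ^ ((E + h') * Q i) \<ge> 1 / (2 * real_of_int q) ^ (K * (E + h'))"
        using upper_pow[of "E + h'"] \<beta> q2 by (intro divide_left_mono) auto
      moreover have "1 / (2 * real_of_int q) ^ (K * (E + h')) \<ge> 1 / (2 * real_of_int q) ^ F"
        using q2 unfolding F_def by (intro divide_left_mono power_increasing) auto
      ultimately show ?thesis by linarith
    next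
      case False
      then have "\<bar>P i * q - p * R i\<bar> \<ge> 1" by linarith
      then have 1: "\<bar>real_of_int (P i) * q - real_of_int p * R i\<bar> \<ge> 1"
        by (metis of_int_1 of_int_abs of_int_diff of_int_le_iff of_int_mult)
      \<comment> \<open>Here the factor 2 in the choice of \<open>i\<close> counts:
        \<open>T i * q\<close> has size at most 1/2 and cannot cancel the nonzero integer
        \<open>P i * q - p * R i\<close>.\<close>
      have "\<bar>T i\<bar> \<le> 1 / (2 * q)"
      proof -
        have "1 / real \<beta> ^ Q i \<le> 1 / (2 * q)"
          using i q2 \<beta> by (intro divide_left_mono) auto
        with T_upper[of i] show ?thesis by linarith
      qed
      then have "\<bar>T i * q\<bar> \<le> 1 / 2"
        using q2 by (simp add: abs_mult field_simps)
      with 1 have "1 / 2 \<le> \<bar>real_of_int (P i) * q - real_of_int p * R i + T i * q\<bar>"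
        by linarith
      then have "1 / 2 / (R i * q)
          \<le> \<bar>real_of_int (P i) * q - real_of_int p * R i + T i * q\<bar> / (R i * q)"
        using R_pos[of i] q2 by (intro divide_right_mono) auto
      also have "\<dots> = \<bar>\<alpha> - p / q\<bar>"
        unfolding dist using R_pos[of i] q2 by (simp add: abs_mult)
      finally have "1 / 2 / (R i * q) \<le> \<bar>\<alpha> - p / q\<bar>" .
      moreover have "R i * (2 * real_of_int q) \<le> (2 * real_of_int q) ^ F"
      proof -
        have "R i * (2 * real_of_int q) \<le> (2 * real_of_int q) ^ (K * h') * (2 * real_of_int q)"
          using R_le[of i] upper_pow[of h'] q2 by (intro mult_right_mono) auto
        also have "\<dots> = (2 * real_of_int q) ^ (1 + K * h')"
          by simp
        also have "\<dots> \<le> (2 * real_of_int q) ^ F"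
          unfolding F_def using q2 by (intro power_increasing) auto
        finally show ?thesis .
      qed
      then have "1 / (2 * real_of_int q) ^ F \<le> 1 / (R i * (2 * real_of_int q))"
        using R_pos[of i] q2 by (intro divide_left_mono) auto
      ultimately show ?thesis by (simp add: mult_ac)
    qed
    moreover have "1 / real_of_int q ^ (2 * F) \<le> 1 / (2 * real_of_int q) ^ F"
      using q2 by (intro two_mult_power_le) auto
    ultimately show ?thesis by linarith
  qed
  have "irrationality_exponent \<alpha> < \<infinity>"
    by (rule irrationality_exponent_finiteI[OF main])
  then show ?thesis
    by (simp add: \<alpha>_def digit_value_def d_def)
qed

section \<open>Weighted digit sums in base \<open>k\<close>\<close>

text \<open>Digit 0 weighs 0 because the first block of the recursion is copied without a
  shift.\<close>

definition digit_weight :: "nat \<Rightarrow> (nat \<Rightarrow> nat \<Rightarrow> nat) \<Rightarrow> nat \<Rightarrow> nat \<Rightarrow> nat" where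
  "digit_weight k \<kappa> i s = (if s = 0 then 0 else \<kappa> s i)"

text \<open>Summing up to \<open>i < m\<close> reaches all nonzero base-\<open>k\<close> digits of \<open>m\<close>, as \<open>m < k ^ m\<close>.\<close>

definition digit_sum :: "nat \<Rightarrow> (nat \<Rightarrow> nat \<Rightarrow> nat) \<Rightarrow> nat \<Rightarrow> nat \<Rightarrow> nat" where
  "digit_sum k \<kappa> j m = (\<Sum>i<m. digit_weight k \<kappa> (j + i) (m div k ^ i mod k))"

lemma less_power_self: "k \<ge> 2 \<Longrightarrow> m < (k::nat) ^ m"
  by (rule less_le_trans[OF less_exp power_mono]) auto

text \<open>Leading zeros weigh 0, so every range that covers the digits of \<open>m\<close> gives
  the same sum.\<close>

lemma digit_sum_eq:
  assumes k: "k \<ge> 2" and m: "m < k ^ n"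
  shows "digit_sum k \<kappa> j m = (\<Sum>i<n. digit_weight k \<kappa> (j + i) (m div k ^ i mod k))"
proof -
  have *: "(\<Sum>i<a. digit_weight k \<kappa> (j + i) (m div k ^ i mod k)) =
        (\<Sum>i<a'. digit_weight k \<kappa> (j + i) (m div k ^ i mod k))" if "m < k ^ a" "a \<le> a'" for a a'
  proof (rule sum.mono_neutral_left)
    show "\<forall>i\<in>{..<a'} - {..<a}. digit_weight k \<kappa> (j + i) (m div k ^ i mod k) = 0"
    proof
      fix i assume "i \<in> {..<a'} - {..<a}"
      then have "k ^ a \<le> k ^ i" using k by (intro power_increasing) auto
      with that have "m div k ^ i = 0" by simp
      then show "digit_weight k \<kappa> (j + i) (m div k ^ i mod k) = 0"
        by (simp add: digit_weight_def)
    qed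
  qed (use that in auto)
  show ?thesis
    using *[of m "max m n"] *[of n "max m n"] m less_power_self[OF k, of m]
    by (simp add: digit_sum_def)
qed

lemma digit_sum_0 [simp]: "digit_sum k \<kappa> j 0 = 0"
  by (simp add: digit_sum_def)

text \<open>No carry occurs: \<open>r\<close> occupies the lowest \<open>n\<close> digits, and the
  digits of \<open>m\<close> move up to the levels from \<open>j + n\<close> on.\<close>

lemma digit_sum_add:
  assumes k: "k \<ge> 2" and r: "r < k ^ n"
  shows "digit_sum k \<kappa> j (r + k ^ n * m) = digit_sum k \<kappa> j r + digit_sum k \<kappa> (j + n) m"
proof -
  let ?w = "digit_weight k \<kappa>" and ?M = "r + k ^ n * m"
  have "?M < k ^ n * Suc m" using r by simp
  also have "\<dots> \<le> k ^ n * k ^ m"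
    using less_power_self[OF k, of m] by (intro mult_left_mono) auto
  finally have "?M < k ^ (n + m)" by (simp add: power_add)
  then have "digit_sum k \<kappa> j ?M = (\<Sum>i<n + m. ?w (j + i) (?M div k ^ i mod k))"
    by (rule digit_sum_eq[OF k])
  also have "\<dots> = (\<Sum>i<n. ?w (j + i) (?M div k ^ i mod k))
      + (\<Sum>i<m. ?w (j + (i + n)) (?M div k ^ (i + n) mod k))"
    unfolding lessThan_atLeast0 
    using sum.atLeastLessThan_concat[of 0 n "n + m" "\<lambda>i. ?w (j + i) (?M div k ^ i mod k)"]
      sum.shift_bounds_nat_ivl[of "\<lambda>i. ?w (j + i) (?M div k ^ i mod k)" 0 n m]
    by (simp add: add.commute)
  also have "(\<Sum>i<n. ?w (j + i) (?M div k ^ i mod k)) = (\<Sum>i<n. ?w (j + i) (r div k ^ i mod k))"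
  proof (rule sum.cong)
    fix i assume "i \<in> {..<n}"
    \<comment> \<open>Below position \<open>n\<close>, the part \<open>k ^ n * m\<close> divided by
      \<open>k ^ i\<close> is still a multiple of \<open>k\<close>, so it does not affect the
      digit.\<close>
    then have "k ^ n = k ^ i * (k * k ^ (n - Suc i))"
      by (simp flip: power_add power_Suc)
    then have "?M = r + k ^ i * (k * (k ^ (n - Suc i) * m))"
      by (simp only: mult_ac)
    moreover have "(r + k ^ i * X) div k ^ i = X + r div k ^ i" for X
      using k by simp
    ultimately have "?M div k ^ i = k * (k ^ (n - Suc i) * m) + r div k ^ i"
      by (simp only:)
    then show "?w (j + i) (?M div k ^ i mod k) = ?w (j + i) (r div k ^ i mod k)"
      by simp
  qed simp
  also have "\<dots> = digit_sum k \<kappa> j r"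
    using digit_sum_eq[OF k r] by simp
  also have "(\<Sum>i<m. ?w (j + (i + n)) (?M div k ^ (i + n) mod k)) = digit_sum k \<kappa> (j + n) m"
  proof -
    have "?M div k ^ (i + n) = m div k ^ i" for i
      using k r by (simp add: power_add mult.commute[of "k ^ i"] div_mult2_eq)
    then show ?thesis by (simp add: digit_sum_def add_ac)
  qed
  finally show ?thesis .
qed

lemma digit_sum_digit:
  assumes "k \<ge> 2" "1 \<le> s" "s < k"
  shows "digit_sum k \<kappa> j s = \<kappa> s j"
  using digit_sum_eq[of k s 1 \<kappa> j] assms by (simp add: digit_weight_def)

lemma digit_sum_power_mult:
  assumes "k \<ge> 2"
  shows "digit_sum k \<kappa> j (k ^ n * m) = digit_sum k \<kappa> (j + n) m"
  using digit_sum_add[of k 0 n \<kappa> j m] assms by simp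

text \<open>All levels involved are at least \<open>N0\<close>, where the weights have period
  \<open>t\<close>. This lets one choice of blocks serve every scale.\<close>

lemma digit_sum_shift_period:
  assumes k: "k \<ge> 2"
    and per: "\<And>s n. 1 \<le> s \<Longrightarrow> s \<le> k - 1 \<Longrightarrow> n \<ge> N0 \<Longrightarrow> \<kappa> s n = \<kappa> s (n + t)"
  shows "digit_sum k \<kappa> (N0 + t * i) m = digit_sum k \<kappa> N0 m"
proof (induction i)
  case (Suc i)
  have "digit_weight k \<kappa> (N0 + t * Suc i + a) (m div k ^ a mod k)
      = digit_weight k \<kappa> (N0 + t * i + a) (m div k ^ a mod k)" for a
  proof -
    have "m div k ^ a mod k \<le> k - 1"
      using k by (metis One_nat_def Suc_pred mod_less_divisor less_Suc_eq_le pos2 order_less_le_trans)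
    then show ?thesis
      using per[of "m div k ^ a mod k" "N0 + t * i + a"]
      by (simp add: digit_weight_def algebra_simps)
  qed
  with Suc show ?case by (simp add: digit_sum_def)
qed simp

section \<open>Letters of the word as digit sums\<close>

lemma concat_uniform_nth:
  assumes "\<And>s. length (f s) = w" "r < w" "s < n"
  shows "concat (map f [0..<n]) ! (s * w + r) = f s ! r"
  using assms(3)
proof (induction n)
  case (Suc n)
  have len: "length (concat (map f [0..<n])) = n * w"
    by (induction n) (simp_all add: assms(1))
  show ?case
  proof (cases "s = n")
    case True
    then show ?thesis using len by (simp add: nth_append)
  next
    case False
    with Suc.prems have "Suc s \<le> n" by simp
    then have "Suc s * w \<le> n * w" by (rule mult_le_mono1)
    then have "s * w + r < n * w" using assms(2) by simp
    then show ?thesis using len False Suc by (simp add: nth_append)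
  qed
qed simp

lemma length_tm_word: "length (tm_word L k \<kappa> n) = k ^ n"
  by (induction n) (simp_all add: length_concat comp_def sum_list_triv)

text \<open>The digit of \<open>m\<close> at position \<open>n\<close> selects the block and
  contributes its shift; the remainder gives the place inside the block.\<close>

lemma tm_word_nth:
  assumes k: "k \<ge> 2" and L: "L > 0" and m: "m < k ^ n"
  shows "tm_word L k \<kappa> n ! m = digit_sum k \<kappa> 0 m mod L"
  using m
proof (induction n arbitrary: m)
  case (Suc n)
  define s r where "s = m div k ^ n" and "r = m mod k ^ n"
  have r: "r < k ^ n" using k by (simp add: r_def)
  have s: "s < k" using Suc.prems by (simp add: s_def less_mult_imp_div_less)
  have m: "m = s * k ^ n + r" unfolding s_def r_def by (rule div_mult_mod_eq[symmetric])
  have "tm_word L k \<kappa> (Suc n) ! m =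
      map (\<lambda>i. if s = 0 then i else (i + \<kappa> s n) mod L) (tm_word L k \<kappa> n) ! r"
    unfolding m tm_word.simps by (rule concat_uniform_nth) (auto simp: length_tm_word r s)
  also have "\<dots> = (digit_sum k \<kappa> 0 r + digit_sum k \<kappa> n s) mod L"
    using Suc.IH[OF r] r s digit_sum_digit[OF k, of s \<kappa> n]
    by (auto simp: length_tm_word mod_simps)
  also have "\<dots> = digit_sum k \<kappa> 0 m mod L"
    using digit_sum_add[OF k r, of \<kappa> 0 s] by (simp add: m add.commute mult.commute)
  finally show ?case .
qed simp

lemma tm_index_eq_digit_sum:
  assumes "k \<ge> 2" "L > 0"
  shows "tm_index L k \<kappa> m = digit_sum k \<kappa> 0 m mod L"
  unfolding tm_index_def
  using less_trans[OF less_power_self[of k m] power_strict_increasing[of m "Suc m" k]] assms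
  by (intro tm_word_nth) auto

section \<open>Periodicity of digit sums modulo \<open>L\<close>\<close>

text \<open>If \<open>k ^ j \<ge> D\<close>, every residue modulo \<open>D\<close> has a representative that does not interfere
  with multiples of \<open>k ^ j\<close>; hence periodicity turns digit sums into a homomorphism on those.\<close>

lemma digit_sum_periodic_imp_linear:
  assumes k: "k \<ge> 2" and D: "D > 0"
    and per: "\<And>c. [digit_sum k \<kappa> j (c + D) = digit_sum k \<kappa> j c] (mod L)"
  shows "\<exists>A. \<forall>s y. 1 \<le> s \<and> s \<le> k - 1 \<longrightarrow> [\<kappa> s (A + y) = \<kappa> 1 A * s * k ^ y] (mod L)"
proof -
  let ?v = "digit_sum k \<kappa> j"
  have per_mult: "[?v (c + a * D) = ?v c] (mod L)" for c a
  proof (induction a)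
    case (Suc a)
    have "[?v (c + a * D + D) = ?v (c + a * D)] (mod L)" by (rule per)
    also note Suc
    finally show ?case by (simp add: algebra_simps)
  qed simp
  have per_mod: "[?v c = ?v (c mod D)] (mod L)" for c
    using per_mult[of "c mod D" "c div D"] by simp
  have add: "[?v (x + k ^ D * m) = ?v x + ?v (k ^ D * m)] (mod L)" for x m
  proof -
    have xD: "x mod D < k ^ D"
      using less_trans[OF mod_less_divisor[OF D] less_power_self[OF k]] .
    have "[?v (x + k ^ D * m) = ?v (x mod D + k ^ D * m)] (mod L)"
      using per_mod[of "x + k ^ D * m"] per_mod[of "x mod D + k ^ D * m"]
      by (simp add: mod_simps cong_def)
    also have "?v (x mod D + k ^ D * m) = ?v (x mod D) + ?v (k ^ D * m)"
      using digit_sum_add[OF k xD] digit_sum_power_mult[OF k] by simp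
    also have "[\<dots> = ?v x + ?v (k ^ D * m)] (mod L)"
      by (rule cong_add[OF cong_sym[OF per_mod] cong_refl])
    finally show ?thesis .
  qed
  \<comment> \<open>\<open>?u m\<close> is \<open>?v (k ^ D * m)\<close>, so \<open>add\<close>
    makes it additive modulo \<open>L\<close>. The witness for \<open>A\<close> is
    \<open>j + D\<close>, with slope \<open>?u 1 = \<kappa> 1 (j + D)\<close>; evaluation at
    \<open>k ^ y * s\<close>, which has the single nonzero digit \<open>s\<close>, recovers
    \<open>\<kappa> s (A + y)\<close>.\<close>
  let ?u = "digit_sum k \<kappa> (j + D)"
  have lin: "[?u m = m * ?u 1] (mod L)" for m
  proof (induction m)
    case (Suc m)
    have "[?u (m + 1) = ?u m + ?u 1] (mod L)"
      using add[of "k ^ D * m" 1] unfolding add_mult_distrib2[symmetric] digit_sum_power_mult[OF k] .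
    also have "[?u m + ?u 1 = m * ?u 1 + ?u 1] (mod L)"
      by (rule cong_add[OF Suc cong_refl])
    finally show ?case by (simp add: add.commute)
  qed simp
  have "[\<kappa> s (j + D + y) = \<kappa> 1 (j + D) * s * k ^ y] (mod L)" if "1 \<le> s" "s \<le> k - 1" for s y
  proof -
    have "?u (k ^ y * s) = \<kappa> s (j + D + y)"
      using that k by (simp add: digit_sum_power_mult digit_sum_digit)
    moreover have "?u 1 = \<kappa> 1 (j + D)"
      using k by (simp add: digit_sum_digit)
    ultimately show ?thesis
      using lin[of "k ^ y * s"] by (simp add: mult_ac)
  qed
  then show ?thesis by blast
qed

text \<open>Pigeonhole on windows of \<open>l + 1\<close> residues. The length is that of the range
  of quotients \<open>(N + n * l) div Q\<close> for \<open>n < Q\<close> and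
  \<open>N < Q\<close>.\<close>

lemma exists_equal_windows:
  fixes v :: "nat \<Rightarrow> nat"
  assumes "L > 0"
  obtains h h' where "h < h'" "\<And>c. c \<le> l \<Longrightarrow> [v (c + h * l) = v (c + h' * l)] (mod L)"
proof -
  let ?st = "\<lambda>h. \<lambda>c\<in>{..l}. v (c + h * l) mod L"
  have "range ?st \<subseteq> {..l} \<rightarrow>\<^sub>E {..<L}"
    using assms by (auto split: if_splits)
  then have "finite (range ?st)"
    by (rule finite_subset) (intro finite_PiE, auto)
  then have "\<not> inj ?st"
    using finite_imageD infinite_UNIV_nat by blast
  then obtain a a' where a: "a \<noteq> a'" "?st a = ?st a'"
    by (auto simp: inj_def)
  have eq: "[v (c + a * l) = v (c + a' * l)] (mod L)" if "c \<le> l" for c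
    using fun_cong[OF a(2), of c] that by (simp add: cong_def)
  show ?thesis
    using that[of a a'] that[of a' a] eq cong_sym[OF eq] a(1) by (meson linorder_neqE_nat)
qed

section \<open>The sequence along an arithmetic progression\<close>

theorem theorem5p3:
  fixes L k \<beta> :: nat and \<kappa> :: "nat \<Rightarrow> nat \<Rightarrow> nat" and av :: "nat \<Rightarrow> complex"
  assumes "L \<ge> 2" and "k \<ge> 2"
    and "\<forall>s n. 1 \<le> s \<and> s \<le> k - 1 \<longrightarrow> \<kappa> s n < L"
    and "inj_on av {0..<L}"
    and "\<beta> > 1"
    and "\<forall>n. \<exists>d < \<beta>. tm_seq L k \<kappa> av n = of_nat d"
    and "n_period k \<kappa>"
  shows "\<forall>N l. l > 0 \<longrightarrow>
           irrationality_exponent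
             (\<Sum>n. Re (tm_seq L k \<kappa> av (N + n * l)) / real \<beta> ^ (n + 1)) < \<infinity>
         \<or> (\<exists>A. \<forall>s y. 1 \<le> s \<and> s \<le> k - 1 \<longrightarrow>
                 [\<kappa> s (A + y) = \<kappa> 1 A * s * k ^ y] (mod L))"
proof (intro allI impI disjCI)
  fix N l :: nat
  assume l: "l > 0"
    and nonexc: "\<nexists>A. \<forall>s y. 1 \<le> s \<and> s \<le> k - 1 \<longrightarrow> [\<kappa> s (A + y) = \<kappa> 1 A * s * k ^ y] (mod L)"
  note k = \<open>k \<ge> 2\<close>
  have L: "L > 0" using \<open>L \<ge> 2\<close> by simp
  obtain dig where dig: "\<And>n. dig n < \<beta>" "\<And>n. tm_seq L k \<kappa> av n = of_nat (dig n)"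
    using assms(6) by metis
  obtain N0 t where t: "t > 0"
    and per: "\<And>s n. 1 \<le> s \<Longrightarrow> s \<le> k - 1 \<Longrightarrow> n \<ge> N0 \<Longrightarrow> \<kappa> s n = \<kappa> s (n + t)"
    using assms(7) unfolding n_period_def by metis
  let ?w = "digit_sum k \<kappa> 0"
  define v where "v = digit_sum k \<kappa> N0"
  have dig_eq_iff: "dig m = dig n \<longleftrightarrow> [?w m = ?w n] (mod L)" for m n
  proof -
    have "dig m = dig n \<longleftrightarrow> tm_seq L k \<kappa> av m = tm_seq L k \<kappa> av n"
      by (simp add: dig(2))
    also have "\<dots> \<longleftrightarrow> tm_index L k \<kappa> m = tm_index L k \<kappa> n"
      unfolding tm_seq_def using inj_on_eq_iff[OF assms(4)] L
      by (simp add: tm_index_eq_digit_sum[OF k L])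
    finally show ?thesis
      by (simp add: tm_index_eq_digit_sum[OF k L] cong_def)
  qed
  \<comment> \<open>The exponent is \<open>N0\<close> plus a multiple of \<open>t\<close>, so the
    higher digits are always weighed by the same \<open>v\<close>; the summand \<open>N + l\<close>
    ensures \<open>Q i \<ge> N + l\<close>.\<close>
  define Q where "Q i = k ^ (N0 + t * (i + (N + l)))" for i
  have Q_ge: "Q i \<ge> N + l" for i
  proof -
    have "N + l \<le> 1 * (i + (N + l))" by simp
    also have "\<dots> \<le> t * (i + (N + l))" using t by (intro mult_right_mono) auto
    also have "\<dots> \<le> N0 + t * (i + (N + l))" by simp
    also have "\<dots> < Q i" unfolding Q_def by (rule less_power_self[OF k])
    finally show ?thesis by simp
  qed
  have w_add: "?w (r + Q i * c) = ?w r + v c" if "r < Q i" for r i c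
    using digit_sum_add[OF k, of r "N0 + t * (i + (N + l))" \<kappa> 0 c] that
      digit_sum_shift_period[where \<kappa> = \<kappa>, OF k per, where i = "i + (N + l)"]
    by (simp add: Q_def v_def)
  \<comment> \<open>Adding a multiple of \<open>Q i\<close> changes only the quotient, so
    comparisons of letters reduce to comparisons of \<open>v\<close>.\<close>
  have w_split: "?w (n + Q i * c) = ?w (n mod Q i) + v (n div Q i + c)" for n i c
  proof -
    have "n + Q i * c = n mod Q i + Q i * (n div Q i + c)"
      by (simp add: add_mult_distrib2)
    then show ?thesis
      using w_add[of "n mod Q i" i "n div Q i + c"] k by (simp add: Q_def)
  qed
  have v_add: "v (r + k ^ (t * z) * c) = v r + v c" if "r < k ^ (t * z)" for r z c
    using digit_sum_add[OF k that, of \<kappa> N0 c] digit_sum_shift_period[where \<kappa> = \<kappa>, OF k per, where i = z]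
    by (simp add: v_def)
  obtain h h' where hh': "h < h'" and win: "\<And>c. c \<le> l \<Longrightarrow> [v (c + h * l) = v (c + h' * l)] (mod L)"
    using exists_equal_windows[OF L, of l v] by metis
  define e where "e = h' - h"
  have "e * l > 0" using hh' l by (simp add: e_def)
  then obtain c0 where c0: "\<not> [v (c0 + e * l) = v c0] (mod L)"
    using digit_sum_periodic_imp_linear[OF k, of "e * l"] nonexc unfolding v_def by blast
  \<comment> \<open>The mismatch at \<open>c0\<close> may lie too far left. Adding
    \<open>k ^ (t * z) * (h * l + 1)\<close> moves it without carries and raises both values of
    \<open>v\<close> equally.\<close>
  define z where "z = c0 + e * l"
  define c1 where "c1 = c0 + k ^ (t * z) * (h * l + 1)"
  have z: "c0 + e * l < k ^ (t * z)"
  proof -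
    have "z \<le> t * z" using t by simp
    then show ?thesis
      using less_power_self[OF k, of "t * z"] z_def by linarith
  qed
  have c1: "\<not> [v (c1 + e * l) = v c1] (mod L)"
  proof -
    have "v (c1 + e * l) = v (c0 + e * l) + v (h * l + 1)" "v c1 = v c0 + v (h * l + 1)"
      using v_add[of "c0 + e * l" z "h * l + 1"] v_add[of c0 z "h * l + 1"] z
      by (simp_all add: c1_def add_ac)
    then show ?thesis using c0 by (simp add: cong_add_rcancel_nat)
  qed
  have c1_ge: "c1 \<ge> h * l + 1"
  proof -
    have "1 * (h * l + 1) \<le> k ^ (t * z) * (h * l + 1)"
      using k by (intro mult_right_mono) auto
    then show ?thesis by (simp add: c1_def)
  qed
  define b where "b n = dig (N + n * l)" for n
  have "irrationality_exponent (\<Sum>n. real (b n) / real \<beta> ^ (n + 1)) < \<infinity>"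
  proof (rule irrationality_exponent_finite_of_repetitions[OF assms(5), where Q = Q and K = "k ^ t"
        and h = h and h' = h' and C = "c1 + 1"])
    show "b n < \<beta>" for n by (simp add: b_def dig)
    show "Q i > 0" for i using k by (simp add: Q_def)
    show "Q (Suc i) = k ^ t * Q i" for i
      by (simp add: Q_def power_add mult_ac)
    show "k ^ t \<ge> 2"
      using k t by (metis One_nat_def Suc_leI le_trans power_increasing power_one_right one_le_numeral)
    show "h < h'" by (rule hh')
    show "b (h * Q i + n) = b (h' * Q i + n)" if n: "n < Q i" for i n
    proof -
      define c where "c = (N + n * l) div Q i"
      have "N + n * l < Q i * (l + 1)"
      proof -
        have "n * l \<le> Q i * l" using n by simp
        moreover have "N < Q i" using Q_ge[of i] l by simp
        ultimately have "N + n * l < Q i * l + Q i" by linarith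
        then show ?thesis by simp
      qed
      then have "c \<le> l"
        unfolding c_def by (metis less_mult_imp_div_less mult.commute Suc_eq_plus1 less_Suc_eq_le)
      then have "[v (c + h * l) = v (c + h' * l)] (mod L)" by (rule win)
      then have "[?w (N + n * l + Q i * (h * l)) = ?w (N + n * l + Q i * (h' * l))] (mod L)"
        unfolding w_split c_def by (rule cong_add[OF cong_refl])
      then show ?thesis
        unfolding b_def dig_eq_iff by (simp add: algebra_simps)
    qed
    show "\<exists>x\<ge>h * Q i. x \<le> (c1 + 1) * Q i \<and> b (x + (h' - h) * Q i) \<noteq> b x" for i
    proof -
      \<comment> \<open>\<open>x\<close> is \<open>(c1 * Q i - N) / l\<close> rounded up, the first
        index with \<open>N + x * l \<ge> c1 * Q i\<close>; as \<open>l \<le> Q i\<close>, the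
        position has quotient exactly \<open>c1\<close>. The \<open>+ 1\<close> in
        \<open>c1 \<ge> h * l + 1\<close> absorbs the offset \<open>N\<close> and yields
        \<open>h * Q i \<le> x\<close>.\<close>
      define y where "y = c1 * Q i - N + l - 1"
      define x where "x = y div l"
      have Q: "Q i \<ge> N + l" by (rule Q_ge)
      have cQ: "(h * l + 1) * Q i \<le> c1 * Q i"
        using c1_ge by (rule mult_le_mono1)
      then have cQN: "N \<le> c1 * Q i" using Q by simp
      have xl: "x * l \<le> y" "y < x * l + l"
        using l dividend_less_div_times[of l y] by (auto simp: x_def)
      have lo: "c1 * Q i \<le> N + x * l" and hi: "N + x * l < c1 * Q i + Q i"
        using xl cQN Q l unfolding y_def by linarith+
      have div: "(N + x * l) div Q i = c1"
        using lo hi by (intro div_nat_eqI) (auto simp: algebra_simps)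
      have "(h * l + 1) * Q i = h * Q i * l + Q i" by (simp add: mult_ac)
      then have "h * Q i * l \<le> x * l"
        using lo cQ Q by linarith
      then have 1: "h * Q i \<le> x" using l by simp
      have "x \<le> x * l" using l by simp
      moreover have "(c1 + 1) * Q i = c1 * Q i + Q i" by simp
      ultimately have 2: "x \<le> (c1 + 1) * Q i"
        using hi by linarith
      have "\<not> [?w (N + x * l + Q i * (e * l)) = ?w (N + x * l + Q i * 0)] (mod L)"
        unfolding w_split div using c1 by (simp add: cong_add_lcancel_nat)
      then have "b (x + e * Q i) \<noteq> b x"
        unfolding b_def dig_eq_iff by (simp add: algebra_simps)
      with 1 2 show ?thesis unfolding e_def by blast
    qed
  qed
  then show "irrationality_exponent
      (\<Sum>n. Re (tm_seq L k \<kappa> av (N + n * l)) / real \<beta> ^ (n + 1)) < \<infinity>"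
    by (simp add: b_def dig)
qed

end
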